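(* For all integers $d\geq 2$, $k\geq 2$ and $r\geq 2d+2$, there exists a claw-free $r$-regular graph on $(r+1)k$ vertices that has no $d$-cut.
   Context: All graphs are finite, simple and undirected. A graph is claw-free if it contains no induced subgraph isomorphic to $K_{1,3}$. A graph is $r$-regular if every vertex has degree exactly $r$. For an integer $d\geq 1$ and a graph $G=(V,E)$, a set $M\subseteq E$ is a $d$-cut of $G$ if $V$ can be partitioned into two non-empty sets $B$ and $R$ such that $M$ is exactly the set of edges with one end in $B$ and the other in $R$, and every vertex of $B$ has at most $d$ neighbours in $R$ and every vertex of $R$ has at most $d$ neighbours in $B$. *)

theory Defs
  imports "Graph_Theory.Graph_Theory"
begin

text \<open>
  A finite simple undirected graph is a \<^locale>\<open>graph\<close> (or \<^locale>\<open>pair_graph\<close>) of the library: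
  a finite loop-free symmetric digraph without parallel arcs.  An undirected edge is
  represented by its two opposite arcs, so the degree of a vertex is its \<^const>\<open>out_degree\<close>,
  and a set of edges is a set of arcs containing both directions of each of its edges.
\<close>

text \<open>
  \<^const>\<open>complete_bipartite_digraph\<close> is a predicate that characterises the complete bipartite
  graphs with given part sizes up to isomorphism.
\<close>

definition claw_free :: "('a, 'b) pre_digraph \<Rightarrow> bool" where
  "claw_free G \<longleftrightarrow>
     \<not> (\<exists>H. induced_subgraph H G \<and> complete_bipartite_digraph 1 3 H)"

definition regular_graph :: "nat \<Rightarrow> ('a, 'b) pre_digraph \<Rightarrow> bool" where
  "regular_graph r G \<longleftrightarrow> (\<forall>v \<in> verts G. out_degree G v = r)"

definition d_cut :: "nat \<Rightarrow> ('a, 'b) pre_digraph \<Rightarrow> 'b set \<Rightarrow> bool" where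
  "d_cut d G M \<longleftrightarrow> M \<subseteq> arcs G \<and>
     (\<exists>B R. B \<noteq> {} \<and> R \<noteq> {} \<and> B \<inter> R = {} \<and> B \<union> R = verts G \<and>
        M = {e \<in> arcs G. tail G e \<in> B \<and> head G e \<in> R \<or> tail G e \<in> R \<and> head G e \<in> B} \<and>
        (\<forall>v \<in> B. card {w \<in> R. v \<rightarrow>\<^bsub>G\<^esub> w} \<le> d) \<and>
        (\<forall>v \<in> R. card {w \<in> B. v \<rightarrow>\<^bsub>G\<^esub> w} \<le> d))"

end

theory Submission
  imports Defs
begin

text \<open>
  Blow up the cycle of length \<open>3k\<close>: replace its vertices by cliques of sizes
  \<open>d + 1, d + 1, r - 1 - 2d\<close>, repeated periodically, and join consecutive cliques completely.
  Three consecutive cliques have \<open>r + 1\<close> vertices in total, which gives \<open>r\<close>-regularity, and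
  every neighbourhood is a union of two cliques, which excludes claws.  Two vertices of the same
  clique have the same closed neighbourhood; if a \<open>d\<close>-cut separated them, this neighbourhood
  would have at most \<open>2d < r + 1\<close> vertices.  So every clique lies on one side of a \<open>d\<close>-cut, and
  so do two consecutive cliques, because one of them has more than \<open>d\<close> vertices.
\<close>

section \<open>Blow-ups of a cycle and their claws\<close>

text \<open>Reflexive on purpose: it then describes closed neighbourhoods, and vertices of equal
  class become adjacent.\<close>

definition cycle_adj :: "nat \<Rightarrow> nat \<Rightarrow> nat \<Rightarrow> bool" where
  "cycle_adj m i j \<longleftrightarrow> i = j \<or> j = Suc i mod m \<or> i = Suc j mod m"

text \<open>The cliques are the fibres of \<open>f\<close>, so their sizes can be prescribed
  separately from the adjacency.\<close>

definition cycle_blow_up :: "'a set \<Rightarrow> ('a \<Rightarrow> nat) \<Rightarrow> nat \<Rightarrow> 'a pair_pre_digraph" where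
  "cycle_blow_up V f m = \<lparr> pverts = V,
     parcs = {(x, y). x \<in> V \<and> y \<in> V \<and> x \<noteq> y \<and> cycle_adj m (f x) (f y)} \<rparr>"

lemma cycle_adj_refl [simp]: "cycle_adj m i i"
  by (simp add: cycle_adj_def)

lemma cycle_adj_sym: "cycle_adj m i j \<Longrightarrow> cycle_adj m j i"
  by (auto simp: cycle_adj_def)

lemma cycle_blow_up_simps [simp]:
  "pverts (cycle_blow_up V f m) = V"
  "(x, y) \<in> parcs (cycle_blow_up V f m) \<longleftrightarrow>
     x \<in> V \<and> y \<in> V \<and> x \<noteq> y \<and> cycle_adj m (f x) (f y)"
  by (auto simp: cycle_blow_up_def)

lemma inj_on_Suc_mod: "inj_on (\<lambda>i. Suc i mod m) {..<m}"
  by (rule inj_onI) (auto simp: mod_Suc split: if_splits)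

lemma pair_graph_cycle_blow_up:
  assumes "finite V"
  shows "pair_graph (cycle_blow_up V f m)"
proof -
  have "parcs (cycle_blow_up V f m) \<subseteq> V \<times> V"
    by (auto simp: cycle_blow_up_def)
  then have "finite (parcs (cycle_blow_up V f m))"
    using assms by (meson finite_SigmaI finite_subset)
  with assms show ?thesis
    by unfold_locales
      (auto simp: symmetric_def intro!: symI dest: cycle_adj_sym)
qed

text \<open>A leaf in the class of the centre would be adjacent to the other leaves. So each of the
  three leaves lies in the preceding or the following class; two of them share a class and are
  adjacent.\<close>

lemma claw_free_cycle_blow_up:
  assumes "f ` V \<subseteq> {..<m}"
  shows "claw_free (with_proj (cycle_blow_up V f m))"
  unfolding claw_free_def
proof
  let ?G = "cycle_blow_up V f m"
  assume "\<exists>H. induced_subgraph H (with_proj ?G) \<and> complete_bipartite_digraph 1 3 H"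
  then obtain H where H: "induced_subgraph H (with_proj ?G)" "complete_bipartite_digraph 1 3 H"
    by blast
  then obtain U W where UW: "verts H = U \<union> W" "U \<inter> W = {}" "card U = 1" "card W = 3"
    "arcs_ends H = U \<times> W \<union> W \<times> U"
    unfolding complete_bipartite_digraph_def by blast
  have sub: "verts H \<subseteq> V" and compat: "tail H = fst" "head H = snd"
    and arcs: "arcs H = {e \<in> parcs ?G. fst e \<in> verts H \<and> snd e \<in> verts H}"
    using H(1) by (auto simp: induced_subgraph_def subgraph_def compatible_def)
  \<comment> \<open>Since \<open>H\<close> is induced, non-adjacency of leaves passes from
    \<open>H\<close> to the blow-up as well.\<close>
  have adj: "(x, y) \<in> arcs_ends H \<longleftrightarrow> (x, y) \<in> parcs ?G" if "x \<in> verts H" "y \<in> verts H" for x y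
    using that by (auto simp: arcs_ends_def arc_to_ends_def compat arcs simp del: cycle_blow_up_simps)
  obtain c where c: "U = {c}"
    using UW(3) card_1_singletonE by blast
  obtain x y z where xyz: "W = {x, y, z}" "x \<noteq> y" "y \<noteq> z" "x \<noteq> z"
    using UW(4) by (auto simp: card_3_iff)
  have leaf: "cycle_adj m (f c) (f w)" "f w < m" if "w \<in> W" for w
  proof -
    have "(c, w) \<in> arcs_ends H" "c \<in> verts H" "w \<in> verts H"
      using that UW(1,5) c by auto
    then show "cycle_adj m (f c) (f w)" "f w < m"
      using adj sub assms by auto
  qed
  have apart: "\<not> cycle_adj m (f v) (f w)" if "v \<in> W" "w \<in> W" "v \<noteq> w" for v w
  proof -
    have "(v, w) \<notin> arcs_ends H" "v \<in> verts H" "w \<in> verts H"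
      using that UW(1,2,5) by auto
    then show ?thesis
      using adj sub that(3) by auto
  qed
  have side: "f w = Suc (f c) mod m \<or> f c = Suc (f w) mod m" if "w \<in> W" for w
  proof -
    have "\<exists>v \<in> W. v \<noteq> w"
      using xyz by auto
    then obtain v where "v \<in> W" "v \<noteq> w" by blast
    then have "f w \<noteq> f c"
      using apart[of w v] leaf(1)[of v] that by auto
    then show ?thesis
      using leaf(1)[OF that] by (auto simp: cycle_adj_def)
  qed
  \<comment> \<open>The successor modulo \<open>m\<close> is injective only below \<open>m\<close>,
    hence the bound recorded in \<open>leaf\<close>.\<close>
  have same: "v = w" if "v \<in> W" "w \<in> W" "f c = Suc (f v) mod m" "f c = Suc (f w) mod m" for v w
    using inj_onD[OF inj_on_Suc_mod[of m], of "f v" "f w"] leaf(2) apart[of v w] that by auto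
  have same': "v = w" if "v \<in> W" "w \<in> W" "f v = Suc (f c) mod m" "f w = Suc (f c) mod m" for v w
    using apart[of v w] that by auto
  have "x \<in> W" "y \<in> W" "z \<in> W"
    using xyz by auto
  then show False
    using side[of x] side[of y] side[of z] same[of x y] same[of y z] same[of x z]
      same'[of x y] same'[of y z] same'[of x z] xyz(2-4) by argo
qed

lemma out_degree_cycle_blow_up:
  assumes "finite V" "x \<in> V"
  shows "Suc (out_degree (with_proj (cycle_blow_up V f m)) x) =
    card {y \<in> V. cycle_adj m (f x) (f y)}"
proof -
  let ?N = "{y \<in> V. cycle_adj m (f x) (f y)}"
  have "out_arcs (with_proj (cycle_blow_up V f m)) x = Pair x ` (?N - {x})"
    using assms(2) by (auto simp: out_arcs_def image_iff)
  then have "out_degree (with_proj (cycle_blow_up V f m)) x = card (?N - {x})"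
    by (simp add: out_degree_def card_image inj_on_def)
  moreover have "x \<in> ?N" "finite ?N"
    using assms by auto
  ultimately show ?thesis
    using card_Suc_Diff1[of ?N x] by simp
qed

section \<open>Cuts of a blow-up\<close>

text \<open>Separated twins share a closed neighbourhood. Its part in \<open>R\<close> is seen by
  \<open>x\<close> and its part in \<open>B\<close> by \<open>y\<close>, and each part has at most
  \<open>d\<close> vertices.\<close>

lemma cut_separates_no_twins:
  assumes "B \<union> R = V" "B \<inter> R = {}"
    and B: "\<forall>v \<in> B. card {w \<in> R. v \<rightarrow>\<^bsub>with_proj (cycle_blow_up V f m)\<^esub> w} \<le> d"
    and R: "\<forall>v \<in> R. card {w \<in> B. v \<rightarrow>\<^bsub>with_proj (cycle_blow_up V f m)\<^esub> w} \<le> d"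
    and large: "\<forall>x \<in> V. 2 * d < card {y \<in> V. cycle_adj m (f x) (f y)}"
    and "x \<in> B" "y \<in> R"
  shows "f x \<noteq> f y"
proof
  assume eq: "f x = f y"
  let ?N = "{w \<in> V. cycle_adj m (f x) (f w)}"
  let ?NR = "{w \<in> R. x \<rightarrow>\<^bsub>with_proj (cycle_blow_up V f m)\<^esub> w}"
  let ?NB = "{w \<in> B. y \<rightarrow>\<^bsub>with_proj (cycle_blow_up V f m)\<^esub> w}"
  \<comment> \<open>The vertices \<open>x\<close> and \<open>y\<close> themselves are covered too:
    each is a neighbour of the other across the cut.\<close>
  have "?N = ?NR \<union> ?NB"
    using assms(1,2,6,7) eq by auto
  then have "card ?N \<le> card ?NR + card ?NB"
    by (simp add: card_Un_le)
  moreover have "2 * d < card ?N"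
    using large assms(1,6) by blast
  ultimately show False
    using B[rule_format, OF \<open>x \<in> B\<close>] R[rule_format, OF \<open>y \<in> R\<close>] by linarith
qed

text \<open>By the twin lemma the whole class of \<open>x\<close> lies in \<open>B\<close> and that
  of \<open>y\<close> in \<open>R\<close>. Hence \<open>y\<close> sees the first class and
  \<open>x\<close> the second across the cut, so both have at most \<open>d\<close> vertices,
  against \<open>wide\<close>.\<close>

lemma cut_separates_no_consecutive_classes:
  assumes "finite V" "B \<union> R = V" "B \<inter> R = {}"
    and B: "\<forall>v \<in> B. card {w \<in> R. v \<rightarrow>\<^bsub>with_proj (cycle_blow_up V f m)\<^esub> w} \<le> d"
    and R: "\<forall>v \<in> R. card {w \<in> B. v \<rightarrow>\<^bsub>with_proj (cycle_blow_up V f m)\<^esub> w} \<le> d"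
    and large: "\<forall>x \<in> V. 2 * d < card {y \<in> V. cycle_adj m (f x) (f y)}"
    and wide: "\<forall>i. Suc i < m \<longrightarrow> d < card {x \<in> V. f x = i} \<or> d < card {x \<in> V. f x = Suc i}"
    and "x \<in> B" "y \<in> R" "f y < m"
  shows "f y \<noteq> Suc (f x)"
proof
  assume eq: "f y = Suc (f x)"
  note twins = cut_separates_no_twins[OF assms(2-6)]
  have fin: "finite B" "finite R"
    using assms(1,2) by auto
  have "{w \<in> V. f w = f x} \<subseteq> {w \<in> B. y \<rightarrow>\<^bsub>with_proj (cycle_blow_up V f m)\<^esub> w}"
  proof
    fix w assume "w \<in> {w \<in> V. f w = f x}"
    moreover from this have "w \<notin> R"
      using twins[OF \<open>x \<in> B\<close>, of w] by auto
    ultimately show "w \<in> {w \<in> B. y \<rightarrow>\<^bsub>with_proj (cycle_blow_up V f m)\<^esub> w}"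
      using assms(2,9,10) eq by (auto simp: cycle_adj_def)
  qed
  then have "card {w \<in> V. f w = f x} \<le> d"
    using R[rule_format, OF \<open>y \<in> R\<close>] fin(1) by (elim order_trans[OF card_mono, rotated]) simp_all
  moreover have "{w \<in> V. f w = Suc (f x)} \<subseteq> {w \<in> R. x \<rightarrow>\<^bsub>with_proj (cycle_blow_up V f m)\<^esub> w}"
  proof
    fix w assume "w \<in> {w \<in> V. f w = Suc (f x)}"
    moreover from this have "w \<notin> B"
      using twins[OF _ \<open>y \<in> R\<close>, of w] eq by auto
    ultimately show "w \<in> {w \<in> R. x \<rightarrow>\<^bsub>with_proj (cycle_blow_up V f m)\<^esub> w}"
      using assms(2,8,10) eq by (auto simp: cycle_adj_def)
  qed
  then have "card {w \<in> V. f w = Suc (f x)} \<le> d"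
    using B[rule_format, OF \<open>x \<in> B\<close>] fin(2) by (elim order_trans[OF card_mono, rotated]) simp_all
  ultimately show False
    using wide[rule_format, of "f x"] \<open>f y < m\<close> eq by auto
qed

text \<open>Walking along the classes \<open>0, ..., m - 1\<close> shows that \<open>B\<close> meets
  all of them or none. As \<open>B\<close> is non-empty it meets the class of some vertex of
  \<open>R\<close>, which separates twins.\<close>

lemma no_d_cut_cycle_blow_up:
  assumes "finite V" and image: "f ` V = {..<m}"
    and large: "\<forall>x \<in> V. 2 * d < card {y \<in> V. cycle_adj m (f x) (f y)}"
    and wide: "\<forall>i. Suc i < m \<longrightarrow> d < card {x \<in> V. f x = i} \<or> d < card {x \<in> V. f x = Suc i}"
  shows "\<not> d_cut d (with_proj (cycle_blow_up V f m)) M"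
proof
  let ?G = "with_proj (cycle_blow_up V f m)"
  assume "d_cut d ?G M"
  then obtain B R where BR: "B \<noteq> {}" "R \<noteq> {}" "B \<inter> R = {}" "B \<union> R = V"
    and B: "\<forall>v \<in> B. card {w \<in> R. v \<rightarrow>\<^bsub>?G\<^esub> w} \<le> d"
    and R: "\<forall>v \<in> R. card {w \<in> B. v \<rightarrow>\<^bsub>?G\<^esub> w} \<le> d"
    unfolding d_cut_def by auto
  have RB: "R \<union> B = V" "R \<inter> B = {}"
    using BR by auto
  note twins = cut_separates_no_twins[OF BR(4,3) B R large]
  note up = cut_separates_no_consecutive_classes[OF assms(1) BR(4,3) B R large wide]
  \<comment> \<open>The conditions on a cut are symmetric, so exchanging \<open>B\<close> and
    \<open>R\<close> handles a lower class in \<open>R\<close>.\<close>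
  note down = cut_separates_no_consecutive_classes[OF assms(1) RB R B large wide]
  have bound: "f v < m" if "v \<in> V" for v
    using image that by auto
  have step: "i \<in> f ` B \<longleftrightarrow> Suc i \<in> f ` B" if i: "Suc i < m" for i
  proof -
    have "i \<in> f ` V" "Suc i \<in> f ` V"
      using image i by auto
    then obtain u v where uv: "u \<in> V" "v \<in> V" "f u = i" "f v = Suc i"
      by auto
    show ?thesis
    proof
      assume "i \<in> f ` B"
      then obtain x where "x \<in> B" "f x = i" by auto
      then have "v \<notin> R"
        using up[of x v] uv i by auto
      then show "Suc i \<in> f ` B"
        using uv BR(4) by force
    next
      assume "Suc i \<in> f ` B"
      then obtain x where "x \<in> B" "f x = Suc i" by auto
      then have "u \<notin> R"
        using down[of u x] uv i by auto
      then show "i \<in> f ` B"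
        using uv BR(4) by force
    qed
  qed
  have const: "i < m \<Longrightarrow> i \<in> f ` B \<longleftrightarrow> 0 \<in> f ` B" for i
    by (induction i) (use step in auto)
  obtain x y where "x \<in> B" "y \<in> R"
    using BR by auto
  then have "f y \<in> f ` B"
    using const[of "f x"] const[of "f y"] bound BR(4) by blast
  then show False
    using twins \<open>y \<in> R\<close> by force
qed

section \<open>Prescribed class sizes\<close>

text \<open>Number the disjoint union of sets of the wanted sizes by an initial segment of the
  naturals, and let \<open>f\<close> read off the first component.\<close>

lemma ex_map_with_fibre_cards:
  fixes s :: "nat \<Rightarrow> nat"
  shows "\<exists>f. f ` {..<\<Sum>i<m. s i} \<subseteq> {..<m} \<and> (\<forall>i<m. card {x \<in> {..<\<Sum>i<m. s i}. f x = i} = s i)"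
proof -
  let ?S = "SIGMA i:{..<m}. {..<s i}"
  have card: "card ?S = (\<Sum>i<m. s i)"
    by simp
  obtain h where h: "bij_betw h {..<\<Sum>i<m. s i} ?S"
    using ex_bij_betw_nat_finite[of ?S] unfolding card atLeast0LessThan by auto
  have "card {x \<in> {..<\<Sum>i<m. s i}. fst (h x) = i} = s i" if "i < m" for i
  proof -
    have "h ` {x \<in> {..<\<Sum>i<m. s i}. fst (h x) = i} = {p \<in> ?S. fst p = i}"
      unfolding bij_betw_imp_surj_on[OF h, symmetric] by auto
    moreover have "{p \<in> ?S. fst p = i} = Pair i ` {..<s i}"
      using that by auto
    moreover have "inj_on h {x \<in> {..<\<Sum>i<m. s i}. fst (h x) = i}"
      using h by (auto simp: bij_betw_def intro: inj_on_subset)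
    ultimately have "card {x \<in> {..<\<Sum>i<m. s i}. fst (h x) = i} = card (Pair i ` {..<s i})"
      using card_image by fastforce
    then show ?thesis
      by (simp add: card_image inj_on_def)
  qed
  moreover have "(fst \<circ> h) ` {..<\<Sum>i<m. s i} \<subseteq> {..<m}"
    unfolding image_comp[symmetric] bij_betw_imp_surj_on[OF h] by auto
  ultimately show ?thesis
    by (intro exI[of _ "fst \<circ> h"]) simp
qed

text \<open>For \<open>3 \<le> m\<close> the class, its successor and its predecessor are distinct,
  so their sizes add up. Adding \<open>m\<close> before subtracting 1 keeps the predecessor of 0
  correct in the naturals.\<close>

lemma card_closed_neighbourhood:
  assumes "finite V" "f ` V \<subseteq> {..<m}" "3 \<le> m" "i < m"
    and fibres: "\<And>j. j < m \<Longrightarrow> card {x \<in> V. f x = j} = s j"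
  shows "card {y \<in> V. cycle_adj m i (f y)} = s i + s (Suc i mod m) + s ((i + m - 1) mod m)"
proof -
  let ?J = "{i, Suc i mod m, (i + m - 1) mod m}"
  have pred: "(i + m - 1) mod m = (if i = 0 then m - 1 else i - 1)"
    using assms(3,4) by (cases i) simp_all
  have J: "cycle_adj m i j \<longleftrightarrow> j \<in> ?J" if "j < m" for j
    using assms(3,4) that
    unfolding pred by (auto simp: cycle_adj_def mod_Suc)
  have lt: "j < m" if "j \<in> ?J" for j
    using that assms(3,4) by auto
  have "{y \<in> V. cycle_adj m i (f y)} = (\<Union>j\<in>?J. {y \<in> V. f y = j})"
    using J assms(2) by auto
  also have "card \<dots> = (\<Sum>j\<in>?J. card {y \<in> V. f y = j})"
    using assms(1) by (intro card_UN_disjoint) auto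
  also have "\<dots> = (\<Sum>j\<in>?J. s j)"
    by (rule sum.cong[OF refl fibres[OF lt]])
  also have "\<dots> = s i + s (Suc i mod m) + s ((i + m - 1) mod m)"
  proof -
    have "i \<noteq> Suc i mod m" "i \<noteq> (i + m - 1) mod m" "Suc i mod m \<noteq> (i + m - 1) mod m"
      using assms(3,4) unfolding pred by (auto simp: mod_Suc)
    then show ?thesis by simp
  qed
  finally show ?thesis .
qed

text \<open>Reduction modulo \<open>3 * k\<close> preserves residues modulo 3, and \<open>i\<close>,
  \<open>i + 1\<close>, \<open>i - 1\<close> represent all three of them.\<close>

lemma periodic_three_sum:
  fixes s :: "nat \<Rightarrow> nat"
  assumes "\<And>i. s i = s (i mod 3)" "k > 0"
  shows "s i + s (Suc i mod (3 * k)) + s ((i + 3 * k - 1) mod (3 * k)) = s 0 + s 1 + s 2"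
proof -
  have red: "s (j mod (3 * k)) = s (j mod 3)" for j
    using assms(1)[of "j mod (3 * k)"] by (simp add: mod_mod_cancel)
  have "(i + 3 * k - 1) mod 3 = (i + 2) mod 3"
    using assms(2) by (cases k) (simp_all add: algebra_simps, presburger)
  then have "s ((i + 3 * k - 1) mod (3 * k)) = s ((i + 2) mod 3)"
    by (simp only: red)
  moreover have "i mod 3 = 0 \<or> i mod 3 = 1 \<or> i mod 3 = 2"
    by linarith
  ultimately show ?thesis
    using assms(1)[of i] red[of "Suc i"] mod_Suc[of i 3] mod_Suc[of "Suc i" 3] by (auto simp: numeral_2_eq_2)
qed

lemma periodic_sum:
  fixes s :: "nat \<Rightarrow> nat"
  assumes "\<And>i. s i = s (i mod 3)"
  shows "(\<Sum>i<3 * k. s i) = (s 0 + s 1 + s 2) * k"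
proof (induction k)
  case (Suc k)
  have "s (3 * k) = s 0" "s (Suc (3 * k)) = s 1" "s (Suc (Suc (3 * k))) = s 2"
    using assms[of "3 * k"] assms[of "Suc (3 * k)"] assms[of "Suc (Suc (3 * k))"]
    by (simp_all add: mod_Suc numeral_2_eq_2)
  moreover have
    "{..<3 * Suc k} = insert (Suc (Suc (3 * k))) (insert (Suc (3 * k)) (insert (3 * k) {..<3 * k}))"
    by auto
  ultimately show ?case
    using Suc by simp
qed simp

theorem theorem3p3:
  fixes d k r :: nat
  assumes "d \<ge> 2" and "k \<ge> 2" and "r \<ge> 2 * d + 2"
  shows "\<exists>G :: nat pair_pre_digraph.
           pair_graph G \<and> card (pverts G) = (r + 1) * k \<and>
           claw_free (with_proj G) \<and> regular_graph r (with_proj G) \<and>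
           \<not> (\<exists>M. d_cut d (with_proj G) M)"
proof -
  \<comment> \<open>Of two consecutive indices at most one is 2 modulo 3, so one of the two classes
    has \<open>d + 1\<close> vertices. The bound on \<open>r\<close> keeps the subtraction exact and
    the third size positive; it may be as small as 1.\<close>
  define s where "s i = (if i mod 3 = 2 then r - 1 - 2 * d else d + 1)" for i :: nat
  have per: "s i = s (i mod 3)" for i
    by (simp add: s_def)
  have s_sum: "s 0 + s 1 + s 2 = r + 1"
    using assms(3) by (simp add: s_def)
  define V where "V = {..<\<Sum>i<3 * k. s i}"
  have V: "finite V" "card V = (r + 1) * k"
    using periodic_sum[of s k, OF per] s_sum by (simp_all add: V_def)
  obtain f where f: "f ` V \<subseteq> {..<3 * k}"
    and fibres: "\<And>i. i < 3 * k \<Longrightarrow> card {x \<in> V. f x = i} = s i"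
    using ex_map_with_fibre_cards[of s "3 * k"] unfolding V_def by blast
  have nbh: "card {y \<in> V. cycle_adj (3 * k) (f x) (f y)} = r + 1" if "x \<in> V" for x
    using card_closed_neighbourhood[of V f "3 * k" "f x" s] periodic_three_sum[of s k "f x", OF per]
      V f fibres that assms(2) s_sum by auto
  \<comment> \<open>No class is empty, as the walk along all classes in
    \<open>no_d_cut_cycle_blow_up\<close> requires.\<close>
  have image: "f ` V = {..<3 * k}"
  proof
    show "{..<3 * k} \<subseteq> f ` V"
    proof
      fix i assume i: "i \<in> {..<3 * k}"
      have "s i > 0"
        using assms(3) by (simp add: s_def)
      then have "{x \<in> V. f x = i} \<noteq> {}"
        using fibres[of i] i by (metis card.empty lessThan_iff less_irrefl)
      then show "i \<in> f ` V" by auto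
    qed
  qed (rule f)
  let ?G = "cycle_blow_up V f (3 * k)"
  have "regular_graph r (with_proj ?G)"
    using out_degree_cycle_blow_up[OF V(1), of _ f "3 * k"] nbh by (auto simp: regular_graph_def)
  moreover have "\<not> d_cut d (with_proj ?G) M" for M
  proof (rule no_d_cut_cycle_blow_up[OF V(1) image])
    show "\<forall>x \<in> V. 2 * d < card {y \<in> V. cycle_adj (3 * k) (f x) (f y)}"
      using nbh assms(3) by simp
    show "\<forall>i. Suc i < 3 * k \<longrightarrow> d < card {x \<in> V. f x = i} \<or> d < card {x \<in> V. f x = Suc i}"
      using fibres by (auto simp: s_def mod_Suc)
  qed
  ultimately show ?thesis
    using pair_graph_cycle_blow_up[OF V(1)] claw_free_cycle_blow_up[OF f] V(2)
    by (intro exI[of _ ?G]) simp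
qed

end
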